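(* Let $X$ be a fixed complete matching. For every $\alpha>0$, $X$ supports an $\alpha$-core if and only if there exists a vector $z=(z_j)_{j\in W}\ge 0$ such that $\alpha R_i(X,z)\le 1$ for all firms $i\in F$. Moreover, with $$\Phi(X)=\min_{z\ge 0}\max_{i\in F}R_i(X,z),$$ one has $$\alpha(X)=\frac{1}{\Phi(X)}.$$
   Context: Market: $F=\{1,\dots,m\}$ is the set of firms, $W=\{1,\dots,n\}$ the set of workers; firm $i$ values worker $j$ at $a_{ij}\ge 0$, and values are additive: $V_i(T)=\sum_{j\in T}a_{ij}$ for $T\subseteq W$. A complete matching $X=(X_1,\dots,X_m)$ is a partition of $W$ (parts may be empty), $X_i$ being the set of workers employed by firm $i$. Put $B_i=V_i(X_i)$. Core: firm profits $x_i\ge 0$ and worker wages $y_j\ge 0$ satisfy local financing if $x_i+\sum_{j\in X_i}y_j=B_i$ for all $i$. For $I\subseteq F$, $T\subseteq W$ let $v(I,T)=\sum_{j\in T}\max_{i\in I}a_{ij}$ (and $v(\varnothing,T)=0$). The outcome $(X,x,y)$ is in the $\alpha$-core if $\sum_{i\in I}x_i+\sum_{j\in T}y_j\ge \alpha\, v(I,T)$ for all $I\subseteq F$, $T\subseteq W$. The matching $X$ supports an $\alpha$-core if there are nonnegative $x,y$ satisfying local financing such that $(X,x,y)$ is in the $\alpha$-core; $\alpha(X)$ is the largest $\alpha$ such that $X$ supports an $\alpha$-core (a supremum in $[0,+\infty]$). Stabilization ratio: write $[u]_+=\max\{u,0\}$. For $z\ge 0$ let $G_i(z)=\max_{T\subseteq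 W}\sum_{j\in T}(a_{ij}-z_j)=\sum_{j\in W}[a_{ij}-z_j]_+$ and $D_i(X,z)=\sum_{j\in X_i}z_j+G_i(z)$. If $B_i>0$, $R_i(X,z)=D_i(X,z)/B_i$; if $B_i=0<D_i(X,z)$, $R_i(X,z)=+\infty$; if $B_i=D_i(X,z)=0$, $R_i(X,z)=0$. Conventions: $1/(+\infty)=0$ and $1/0=+\infty$. *)

theory Defs
  imports "HOL-Library.Extended_Nonnegative_Real" "HOL-Library.Disjoint_Sets"
begin

text \<open>
  Firms are \<open>{1..m}\<close>, workers are \<open>{1..n}\<close>, and \<open>a i j\<close> is the value of worker \<open>j\<close> to
  firm \<open>i\<close>. Vectors and matrices are functions on \<open>nat\<close> whose values outside these index
  sets play no role.
\<close>

definition nonneg_on :: "nat set \<Rightarrow> (nat \<Rightarrow> real) \<Rightarrow> bool" where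
  "nonneg_on S u \<longleftrightarrow> (\<forall>k\<in>S. 0 \<le> u k)"

definition complete_matching :: "nat \<Rightarrow> nat \<Rightarrow> (nat \<Rightarrow> nat set) \<Rightarrow> bool" where
  "complete_matching m n X \<longleftrightarrow> (\<Union>i\<in>{1..m}. X i) = {1..n} \<and> disjoint_family_on X {1..m}"

definition firm_value :: "(nat \<Rightarrow> nat \<Rightarrow> real) \<Rightarrow> nat \<Rightarrow> nat set \<Rightarrow> real" where
  "firm_value a i T = (\<Sum>j\<in>T. a i j)"

definition local_financing ::
  "nat \<Rightarrow> (nat \<Rightarrow> nat \<Rightarrow> real) \<Rightarrow> (nat \<Rightarrow> nat set) \<Rightarrow> (nat \<Rightarrow> real) \<Rightarrow> (nat \<Rightarrow> real) \<Rightarrow> bool" where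
  "local_financing m a X x y \<longleftrightarrow>
     (\<forall>i\<in>{1..m}. x i + (\<Sum>j\<in>X i. y j) = firm_value a i (X i))"

definition coalition_value :: "(nat \<Rightarrow> nat \<Rightarrow> real) \<Rightarrow> nat set \<Rightarrow> nat set \<Rightarrow> real" where
  "coalition_value a I T = (if I = {} then 0 else (\<Sum>j\<in>T. Max ((\<lambda>i. a i j) ` I)))"

definition in_core ::
  "nat \<Rightarrow> nat \<Rightarrow> (nat \<Rightarrow> nat \<Rightarrow> real) \<Rightarrow> real \<Rightarrow> (nat \<Rightarrow> real) \<Rightarrow> (nat \<Rightarrow> real) \<Rightarrow> bool" where
  "in_core m n a \<alpha> x y \<longleftrightarrow>
     (\<forall>I T. I \<subseteq> {1..m} \<longrightarrow> T \<subseteq> {1..n} \<longrightarrow>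
        (\<Sum>i\<in>I. x i) + (\<Sum>j\<in>T. y j) \<ge> \<alpha> * coalition_value a I T)"

definition supports_core ::
  "nat \<Rightarrow> nat \<Rightarrow> (nat \<Rightarrow> nat \<Rightarrow> real) \<Rightarrow> (nat \<Rightarrow> nat set) \<Rightarrow> real \<Rightarrow> bool" where
  "supports_core m n a X \<alpha> \<longleftrightarrow>
     (\<exists>x y. nonneg_on {1..m} x \<and> nonneg_on {1..n} y \<and>
            local_financing m a X x y \<and> in_core m n a \<alpha> x y)"

definition core_ratio ::
  "nat \<Rightarrow> nat \<Rightarrow> (nat \<Rightarrow> nat \<Rightarrow> real) \<Rightarrow> (nat \<Rightarrow> nat set) \<Rightarrow> ennreal" where
  "core_ratio m n a X = (SUP \<alpha>\<in>{\<alpha>. 0 \<le> \<alpha> \<and> supports_core m n a X \<alpha>}. ennreal \<alpha>)"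

definition surplus :: "nat \<Rightarrow> (nat \<Rightarrow> nat \<Rightarrow> real) \<Rightarrow> (nat \<Rightarrow> real) \<Rightarrow> nat \<Rightarrow> real" where
  "surplus n a z i = Max ((\<lambda>T. \<Sum>j\<in>T. a i j - z j) ` Pow {1..n})"

lemma surplus_eq_sum_pos_part: "surplus n a z i = (\<Sum>j\<in>{1..n}. max (a i j - z j) 0)"
proof -
  let ?f = "\<lambda>j. a i j - z j"
  let ?T = "{j\<in>{1..n}. 0 \<le> ?f j}"
  have "sum ?f T \<le> (\<Sum>j\<in>{1..n}. max (?f j) 0)" if "T \<subseteq> {1..n}" for T
  proof -
    have "sum ?f T \<le> (\<Sum>j\<in>T. max (?f j) 0)"
      by (intro sum_mono) simp
    also have "\<dots> \<le> (\<Sum>j\<in>{1..n}. max (?f j) 0)"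
      by (intro sum_mono2) (use that in auto)
    finally show ?thesis .
  qed
  moreover have "(\<Sum>j\<in>{1..n}. max (?f j) 0) = sum ?f ?T"
    by (intro sum.mono_neutral_cong_right) auto
  ultimately show ?thesis
    unfolding surplus_def by (intro Max_eqI) auto
qed

definition stab_numerator ::
  "nat \<Rightarrow> (nat \<Rightarrow> nat \<Rightarrow> real) \<Rightarrow> (nat \<Rightarrow> nat set) \<Rightarrow> (nat \<Rightarrow> real) \<Rightarrow> nat \<Rightarrow> real" where
  "stab_numerator n a X z i = (\<Sum>j\<in>X i. z j) + surplus n a z i"

text \<open>
  For \<open>a, z \<ge> 0\<close> both quantities in the quotient are nonnegative, so \<^const>\<open>ennreal\<close> does
  not truncate.
\<close>

definition stab_ratio ::
  "nat \<Rightarrow> (nat \<Rightarrow> nat \<Rightarrow> real) \<Rightarrow> (nat \<Rightarrow> nat set) \<Rightarrow> (nat \<Rightarrow> real) \<Rightarrow> nat \<Rightarrow> ennreal" where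
  "stab_ratio n a X z i =
     (if firm_value a i (X i) > 0
      then ennreal (stab_numerator n a X z i / firm_value a i (X i))
      else if stab_numerator n a X z i > 0 then \<infinity> else 0)"

text \<open>
  The supremum over the finite set \<open>{1..m}\<close> is a maximum (and \<open>0\<close> if \<open>m = 0\<close>). The minimum
  over \<open>z\<close> is written as an infimum; that it is attained has to be stated separately.
\<close>

definition max_stab_ratio ::
  "nat \<Rightarrow> nat \<Rightarrow> (nat \<Rightarrow> nat \<Rightarrow> real) \<Rightarrow> (nat \<Rightarrow> nat set) \<Rightarrow> (nat \<Rightarrow> real) \<Rightarrow> ennreal" where
  "max_stab_ratio m n a X z = (SUP i\<in>{1..m}. stab_ratio n a X z i)"

definition stab_index ::
  "nat \<Rightarrow> nat \<Rightarrow> (nat \<Rightarrow> nat \<Rightarrow> real) \<Rightarrow> (nat \<Rightarrow> nat set) \<Rightarrow> ennreal" where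
  "stab_index m n a X = (INF z\<in>{z. nonneg_on {1..n} z}. max_stab_ratio m n a X z)"

text \<open>Division on \<^typ>\<open>ennreal\<close> has the required conventions at \<open>0\<close> and \<open>\<infinity>\<close>.\<close>

lemma "1 / (\<infinity> :: ennreal) = 0" and "1 / (0 :: ennreal) = \<infinity>"
  by (simp_all add: divide_ennreal_def)

end

theory Submission
  imports Defs "HOL-Analysis.Function_Topology"
begin

text \<open>
  Setting \<open>y = \<alpha> z\<close> and letting local financing determine \<open>x\<close>, the core inequalities for a
  single firm \<open>i\<close> against all \<open>T\<close> say \<open>\<alpha> G\<^sub>i(z) \<le> x\<^sub>i\<close>, that is \<open>\<alpha> D\<^sub>i(X,z) \<le> B\<^sub>i\<close>. They imply the
  inequalities for all coalitions, because \<open>max\<^sub>i a\<^sub>i\<^sub>j - z\<^sub>j\<close> is at most the sum over \<open>i\<close> of the positive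
  parts \<open>[a\<^sub>i\<^sub>j - z\<^sub>j]\<^sub>+\<close>. For the minimum, capping every \<open>z\<^sub>j\<close> at an upper bound of all values does
  not increase any \<open>D\<^sub>i\<close>, so one minimises \<open>t\<close> over the compact set of pairs \<open>(z,t)\<close> in a box with
  \<open>D\<^sub>i(X,z) \<le> t B\<^sub>i\<close>; this formulation needs no case distinction on \<open>B\<^sub>i = 0\<close>.
\<close>

section \<open>Surpluses and coalition values\<close>

lemma surplus_nonneg: "0 \<le> surplus n a z i"
  unfolding surplus_eq_sum_pos_part by (intro sum_nonneg) simp

lemma surplus_ge:
  assumes "T \<subseteq> {1..n}"
  shows "(\<Sum>j\<in>T. a i j - z j) \<le> surplus n a z i"
  unfolding surplus_def using assms by (intro Max_ge) auto

lemma surplus_le: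
  assumes "\<And>T. T \<subseteq> {1..n} \<Longrightarrow> (\<Sum>j\<in>T. a i j - z j) \<le> c"
  shows "surplus n a z i \<le> c"
  unfolding surplus_def using assms by (subst Max_le_iff) auto

text \<open>Worker by worker: the firm attaining the maximum contributes its own positive part to
  the sum over \<open>I\<close>, and the other terms are nonnegative. As \<open>I\<close> contains a
  firm, \<open>z\<close> may have any sign here.\<close>

lemma coalition_value_le_sum_surplus:
  assumes "finite I" "I \<noteq> {}" "T \<subseteq> {1..n}"
  shows "coalition_value a I T \<le> (\<Sum>i\<in>I. surplus n a z i) + (\<Sum>j\<in>T. z j)"
proof -
  have "Max ((\<lambda>i. a i j) ` I) \<le> (\<Sum>i\<in>I. max (a i j - z j) 0) + z j" for j
  proof -
    have "a i j \<le> (\<Sum>i\<in>I. max (a i j - z j) 0) + z j" if "i \<in> I" for i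
      using member_le_sum[of i I "\<lambda>i. max (a i j - z j) 0"] assms(1) that by simp
    then show ?thesis
      using assms(1,2) by simp
  qed
  then have "coalition_value a I T \<le> (\<Sum>j\<in>T. (\<Sum>i\<in>I. max (a i j - z j) 0) + z j)"
    using assms(2) by (auto simp: coalition_value_def intro: sum_mono)
  also have "\<dots> = (\<Sum>i\<in>I. \<Sum>j\<in>T. max (a i j - z j) 0) + (\<Sum>j\<in>T. z j)"
    by (simp add: sum.distrib sum.swap[of _ T I])
  also have "(\<Sum>i\<in>I. \<Sum>j\<in>T. max (a i j - z j) 0) \<le> (\<Sum>i\<in>I. surplus n a z i)"
    unfolding surplus_eq_sum_pos_part using assms(3) by (intro sum_mono sum_mono2) auto
  finally show ?thesis
    by simp
qed

section \<open>Ratio bounds as real inequalities\<close>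

lemma matching_subset:
  assumes "complete_matching m n X" "i \<in> {1..m}"
  shows "X i \<subseteq> {1..n}"
  using assms unfolding complete_matching_def by blast

lemma firm_value_nonneg:
  assumes "\<forall>i\<in>{1..m}. \<forall>j\<in>{1..n}. 0 \<le> a i j" "complete_matching m n X" "i \<in> {1..m}"
  shows "0 \<le> firm_value a i (X i)"
  unfolding firm_value_def using assms matching_subset[OF assms(2,3)] by (intro sum_nonneg) auto

lemma stab_numerator_nonneg:
  assumes "complete_matching m n X" "i \<in> {1..m}" "nonneg_on {1..n} z"
  shows "0 \<le> stab_numerator n a X z i"
  unfolding stab_numerator_def using assms(3) matching_subset[OF assms(1,2)]
  by (intro add_nonneg_nonneg sum_nonneg surplus_nonneg) (auto simp: nonneg_on_def)

text \<open>The product form also covers firms of value 0: there it forces the nonnegative numerator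
  to be 0, which is exactly when the ratio is 0 and not infinite.\<close>

lemma stab_ratio_le_iff:
  assumes "\<forall>i\<in>{1..m}. \<forall>j\<in>{1..n}. 0 \<le> a i j" "complete_matching m n X" "i \<in> {1..m}"
    and "nonneg_on {1..n} z" "0 \<le> t"
  shows "stab_ratio n a X z i \<le> ennreal t \<longleftrightarrow> stab_numerator n a X z i \<le> t * firm_value a i (X i)"
proof (cases "firm_value a i (X i) > 0")
  case True
  then show ?thesis
    using assms(5) by (simp add: stab_ratio_def pos_divide_le_eq)
next
  case False
  then have "firm_value a i (X i) = 0"
    using firm_value_nonneg[OF assms(1-3)] by simp
  then show ?thesis
    using stab_numerator_nonneg[OF assms(2,3,4), of a] by (auto simp: stab_ratio_def top_unique)
qed

lemma max_stab_ratio_le_iff: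
  assumes "\<forall>i\<in>{1..m}. \<forall>j\<in>{1..n}. 0 \<le> a i j" "complete_matching m n X"
    and "nonneg_on {1..n} z" "0 \<le> t"
  shows "max_stab_ratio m n a X z \<le> ennreal t \<longleftrightarrow>
    (\<forall>i\<in>{1..m}. stab_numerator n a X z i \<le> t * firm_value a i (X i))"
  using stab_ratio_le_iff[OF assms(1,2) _ assms(3,4)]
  by (auto simp: max_stab_ratio_def SUP_le_iff)

lemma ennreal_mult_le_one_iff:
  assumes "0 < \<alpha>"
  shows "ennreal \<alpha> * r \<le> 1 \<longleftrightarrow> r \<le> ennreal (1 / \<alpha>)"
proof (cases r)
  case (real s)
  then have "ennreal \<alpha> * r = ennreal (\<alpha> * s)"
    using assms by (simp add: ennreal_mult)
  then show ?thesis
    using real assms by (simp add: field_simps)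
next
  case top
  then show ?thesis
    using assms by (simp add: ennreal_mult_top top_unique)
qed

section \<open>Core support through the vector \<open>z\<close>\<close>

lemma supports_core_iff:
  assumes a: "\<forall>i\<in>{1..m}. \<forall>j\<in>{1..n}. 0 \<le> a i j" and X: "complete_matching m n X" and "0 < \<alpha>"
  shows "supports_core m n a X \<alpha> \<longleftrightarrow>
    (\<exists>z. nonneg_on {1..n} z \<and>
      (\<forall>i\<in>{1..m}. \<alpha> * stab_numerator n a X z i \<le> firm_value a i (X i)))"
proof
  assume "supports_core m n a X \<alpha>"
  then obtain x y where y: "nonneg_on {1..n} y" and lf: "local_financing m a X x y"
    and core: "in_core m n a \<alpha> x y"
    unfolding supports_core_def by blast
  define z where "z = (\<lambda>j. y j / \<alpha>)"
  have yz: "(\<Sum>j\<in>T. y j) = \<alpha> * (\<Sum>j\<in>T. z j)" for T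
    using \<open>0 < \<alpha>\<close> by (simp add: z_def sum_distrib_left)
  have "\<alpha> * stab_numerator n a X z i \<le> firm_value a i (X i)" if i: "i \<in> {1..m}" for i
  proof -
    \<comment> \<open>The surplus is a maximum over \<open>T\<close>, so the coalitions with the
      single firm \<open>i\<close> bound it; for them the coalition value is just the sum of
      \<open>a i j\<close>.\<close>
    have "surplus n a z i \<le> x i / \<alpha>"
    proof (rule surplus_le)
      fix T assume "T \<subseteq> {1..n}"
      then have "\<alpha> * coalition_value a {i} T \<le> (\<Sum>i\<in>{i}. x i) + (\<Sum>j\<in>T. y j)"
        using core i unfolding in_core_def by blast
      then have "\<alpha> * (\<Sum>j\<in>T. a i j - z j) \<le> x i"
        by (simp add: coalition_value_def yz sum_subtractf right_diff_distrib)
      then show "(\<Sum>j\<in>T. a i j - z j) \<le> x i / \<alpha>"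
        using \<open>0 < \<alpha>\<close> by (simp add: field_simps)
    qed
    then have "\<alpha> * surplus n a z i \<le> x i"
      using \<open>0 < \<alpha>\<close> by (simp add: field_simps)
    moreover have "x i + (\<Sum>j\<in>X i. y j) = firm_value a i (X i)"
      using lf i unfolding local_financing_def by blast
    ultimately show ?thesis
      by (simp add: stab_numerator_def yz distrib_left)
  qed
  moreover have "nonneg_on {1..n} z"
    using y \<open>0 < \<alpha>\<close> by (simp add: nonneg_on_def z_def)
  ultimately show "\<exists>z. nonneg_on {1..n} z \<and>
      (\<forall>i\<in>{1..m}. \<alpha> * stab_numerator n a X z i \<le> firm_value a i (X i))"
    by blast
next
  assume "\<exists>z. nonneg_on {1..n} z \<and>
      (\<forall>i\<in>{1..m}. \<alpha> * stab_numerator n a X z i \<le> firm_value a i (X i))"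
  then obtain z where z: "nonneg_on {1..n} z"
    and le: "\<And>i. i \<in> {1..m} \<Longrightarrow> \<alpha> * stab_numerator n a X z i \<le> firm_value a i (X i)"
    by blast
  define y where "y = (\<lambda>j. \<alpha> * z j)"
  define x where "x = (\<lambda>i. firm_value a i (X i) - (\<Sum>j\<in>X i. y j))"
  \<comment> \<open>The gap between the two sides is exactly the slack in the assumed inequality for
    firm \<open>i\<close>.\<close>
  have x: "\<alpha> * surplus n a z i \<le> x i" if "i \<in> {1..m}" for i
    using le[OF that] by (simp add: stab_numerator_def x_def y_def distrib_left sum_distrib_left)
  have y0: "nonneg_on {1..n} y"
    using z \<open>0 < \<alpha>\<close> by (simp add: nonneg_on_def y_def)
  have "\<alpha> * coalition_value a I T \<le> (\<Sum>i\<in>I. x i) + (\<Sum>j\<in>T. y j)"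
    if I: "I \<subseteq> {1..m}" and T: "T \<subseteq> {1..n}" for I T
  proof (cases "I = {}")
    \<comment> \<open>Without firms the coalition value is 0 by convention, and nonnegative wages
      suffice.\<close>
    case True
    then show ?thesis
      using y0 T by (auto simp: coalition_value_def nonneg_on_def intro: sum_nonneg)
  next
    case False
    have "finite I"
      using I by (rule finite_subset) simp
    then have "\<alpha> * coalition_value a I T \<le> \<alpha> * ((\<Sum>i\<in>I. surplus n a z i) + (\<Sum>j\<in>T. z j))"
      using coalition_value_le_sum_surplus False T \<open>0 < \<alpha>\<close> by (intro mult_left_mono) auto
    also have "\<dots> = (\<Sum>i\<in>I. \<alpha> * surplus n a z i) + (\<Sum>j\<in>T. y j)"
      by (simp add: y_def distrib_left sum_distrib_left)
    also have "(\<Sum>i\<in>I. \<alpha> * surplus n a z i) \<le> (\<Sum>i\<in>I. x i)"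
      using x I by (intro sum_mono) auto
    finally show ?thesis
      by simp
  qed
  then have "in_core m n a \<alpha> x y"
    unfolding in_core_def by blast
  moreover have "local_financing m a X x y"
    by (simp add: local_financing_def x_def)
  moreover have "nonneg_on {1..m} x"
    unfolding nonneg_on_def
  proof
    fix i assume "i \<in> {1..m}"
    then have "\<alpha> * surplus n a z i \<le> x i"
      by (rule x)
    moreover have "0 \<le> \<alpha> * surplus n a z i"
      using \<open>0 < \<alpha>\<close> surplus_nonneg[of n a z i] by simp
    ultimately show "0 \<le> x i"
      by linarith
  qed
  ultimately show "supports_core m n a X \<alpha>"
    using y0 unfolding supports_core_def by blast
qed

lemma supports_core_iff_max_stab_ratio:
  assumes "\<forall>i\<in>{1..m}. \<forall>j\<in>{1..n}. 0 \<le> a i j" "complete_matching m n X" "0 < \<alpha>"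
  shows "supports_core m n a X \<alpha> \<longleftrightarrow>
    (\<exists>z. nonneg_on {1..n} z \<and> max_stab_ratio m n a X z \<le> ennreal (1 / \<alpha>))"
proof -
  have "max_stab_ratio m n a X z \<le> ennreal (1 / \<alpha>) \<longleftrightarrow>
      (\<forall>i\<in>{1..m}. \<alpha> * stab_numerator n a X z i \<le> firm_value a i (X i))"
    if "nonneg_on {1..n} z" for z
    using max_stab_ratio_le_iff[OF assms(1,2) that, of "1 / \<alpha>"] assms(3)
    by (simp add: field_simps)
  then show ?thesis
    using supports_core_iff[OF assms] by blast
qed

section \<open>Attainment of the minimum\<close>

text \<open>Where the cap takes effect, \<open>a i j - z j\<close> is nonpositive before and after,
  so the surplus is unchanged while the sum over \<open>X i\<close> can only fall.\<close>

lemma stab_numerator_cap_le: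
  assumes "X i \<subseteq> {1..n}" "\<And>j. j \<in> {1..n} \<Longrightarrow> a i j \<le> A"
  shows "stab_numerator n a X (\<lambda>j. if j \<in> {1..n} then min (z j) A else 0) i
    \<le> stab_numerator n a X z i"
proof -
  let ?w = "\<lambda>j. if j \<in> {1..n} then min (z j) A else 0"
  have "surplus n a ?w i = surplus n a z i"
    unfolding surplus_eq_sum_pos_part
  proof (rule sum.cong)
    fix j assume "j \<in> {1..n}"
    with assms(2)[OF this] show "max (a i j - ?w j) 0 = max (a i j - z j) 0"
      by (auto simp: min_def max_def)
  qed simp
  moreover have "(\<Sum>j\<in>X i. ?w j) \<le> (\<Sum>j\<in>X i. z j)"
    using assms(1) by (intro sum_mono) auto
  ultimately show ?thesis
    by (simp add: stab_numerator_def)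
qed

lemma continuous_on_stab_numerator:
  "continuous_on S (\<lambda>z. stab_numerator n a X z i)"
proof -
  have "continuous_on S (\<lambda>z. z j)" for j :: nat and S :: "(nat \<Rightarrow> real) set"
    by (rule continuous_on_subset[OF continuous_on_product_coordinates]) simp
  then show ?thesis
    unfolding stab_numerator_def surplus_eq_sum_pos_part by (intro continuous_intros)
qed

text \<open>Tychonoff's theorem, carried over to the topology of the function type.\<close>

lemma compact_box:
  fixes A :: "'i \<Rightarrow> real set"
  assumes "\<And>j. compact (A j)"
  shows "compact {z. \<forall>j. z j \<in> A j}"
proof -
  have "compactin (product_topology (\<lambda>_. euclidean) UNIV) (PiE UNIV A)"
    using assms by (simp add: compactin_PiE)
  moreover have "PiE UNIV A = {z. \<forall>j. z j \<in> A j}"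
    by (auto simp: PiE_def Pi_def)
  ultimately show ?thesis
    by (simp add: euclidean_product_topology flip: compactin_euclidean_iff)
qed

lemma stab_index_attained:
  assumes a: "\<forall>i\<in>{1..m}. \<forall>j\<in>{1..n}. 0 \<le> a i j" and X: "complete_matching m n X"
  shows "\<exists>z. nonneg_on {1..n} z \<and> max_stab_ratio m n a X z = stab_index m n a X"
proof (cases "stab_index m n a X = \<infinity>")
  \<comment> \<open>If the infimum is infinite, every admissible \<open>z\<close> attains
    it.\<close>
  case True
  have "stab_index m n a X \<le> max_stab_ratio m n a X (\<lambda>_. 0)"
    unfolding stab_index_def by (rule INF_lower) (simp add: nonneg_on_def)
  with True show ?thesis
    by (intro exI[of _ "\<lambda>_. 0"]) (simp add: nonneg_on_def top_unique)
next
  case False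
  \<comment> \<open>The total of all values serves as a common upper bound; it is nonnegative even
    for an empty market.\<close>
  define A where "A = (\<Sum>i\<in>{1..m}. \<Sum>j\<in>{1..n}. a i j)"
  have A0: "0 \<le> A"
    unfolding A_def using a by (intro sum_nonneg) auto
  have aA: "a i j \<le> A" if "i \<in> {1..m}" "j \<in> {1..n}" for i j
  proof -
    have "a i j \<le> (\<Sum>j\<in>{1..n}. a i j)"
      using a that by (intro member_le_sum) auto
    also have "\<dots> \<le> A"
      unfolding A_def using a that by (intro member_le_sum[of i]) (auto intro: sum_nonneg)
    finally show ?thesis .
  qed
  let ?cap = "\<lambda>z j. if j \<in> {1..n} then min (z j) A else 0"
  \<comment> \<open>Coordinates outside \<open>{1..n}\<close> are pinned to 0, since compactness is
    required in the space of all functions on \<open>nat\<close>.\<close>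
  define box where "box = {z :: nat \<Rightarrow> real. \<forall>j. z j \<in> (if j \<in> {1..n} then {0..A} else {0})}"
  have box_nonneg: "nonneg_on {1..n} z" if "z \<in> box" for z
    using that unfolding box_def nonneg_on_def by (auto split: if_splits)
  have cap_box: "?cap z \<in> box" if "nonneg_on {1..n} z" for z
    using that A0 by (auto simp: box_def nonneg_on_def)
  have cap_le: "max_stab_ratio m n a X (?cap z) \<le> ennreal t"
    if "nonneg_on {1..n} z" "max_stab_ratio m n a X z \<le> ennreal t" "0 \<le> t" for z t
  proof -
    have "stab_numerator n a X (?cap z) i \<le> stab_numerator n a X z i" if "i \<in> {1..m}" for i
      using matching_subset[OF X that] aA[OF that] by (rule stab_numerator_cap_le)
    then show ?thesis
      using that max_stab_ratio_le_iff[OF a X that(1,3)]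
        max_stab_ratio_le_iff[OF a X box_nonneg[OF cap_box[OF that(1)]] that(3)]
      by (meson order_trans)
  qed
  obtain z0 where z0: "nonneg_on {1..n} z0" "max_stab_ratio m n a X z0 < \<infinity>"
    using False unfolding stab_index_def infinity_ennreal_def less_top INF_less_iff by blast
  then obtain M where M: "0 \<le> M" "max_stab_ratio m n a X z0 = ennreal M"
    by (cases "max_stab_ratio m n a X z0") auto
  \<comment> \<open>The epigraph of the maximal ratio over the box, truncated at the finite value
    \<open>M\<close> reached by \<open>z0\<close>. The truncation gives compactness, and capping
    \<open>z0\<close> shows that the set is nonempty.\<close>
  define S where "S = (box \<times> {0..M}) \<inter>
    (\<Inter>i\<in>{1..m}. {p. stab_numerator n a X (fst p) i \<le> snd p * firm_value a i (X i)})"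
  have S_iff: "(z, t) \<in> S \<longleftrightarrow> z \<in> box \<and> 0 \<le> t \<and> t \<le> M \<and> max_stab_ratio m n a X z \<le> ennreal t"
    for z t
    using max_stab_ratio_le_iff[OF a X box_nonneg] by (auto simp: S_def)
  have "compact box"
    unfolding box_def by (rule compact_box) auto
  moreover have "closed {p. stab_numerator n a X (fst p) i \<le> snd p * firm_value a i (X i)}" for i
    by (intro closed_Collect_le continuous_intros
        continuous_on_compose2[OF continuous_on_stab_numerator[of UNIV]]) auto
  ultimately have "compact S"
    unfolding S_def by (intro compact_Int_closed compact_Times closed_INT) auto
  moreover have "(?cap z0, M) \<in> S"
    using cap_box[OF z0(1)] cap_le[OF z0(1)] M by (simp add: S_iff)
  moreover have "continuous_on S snd"
    by (intro continuous_intros)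
  ultimately obtain p where p: "p \<in> S" "\<And>q. q \<in> S \<Longrightarrow> snd p \<le> snd q"
    using continuous_attains_inf[of S snd] by blast
  obtain z t where zt: "p = (z, t)"
    by (cases p)
  have z: "z \<in> box" "0 \<le> t" "t \<le> M" "max_stab_ratio m n a X z \<le> ennreal t"
    using p(1) by (simp_all add: zt S_iff)
  \<comment> \<open>Minimality extends from the box to all admissible vectors: a better
    \<open>w\<close>, once capped, would give a point of \<open>S\<close> with a smaller second
    coordinate.\<close>
  have "ennreal t \<le> max_stab_ratio m n a X w" if w: "nonneg_on {1..n} w" for w
  proof (rule ccontr)
    assume "\<not> ennreal t \<le> max_stab_ratio m n a X w"
    then have less: "max_stab_ratio m n a X w < ennreal t"
      by simp
    then obtain s where s: "0 \<le> s" "max_stab_ratio m n a X w = ennreal s"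
      by (cases "max_stab_ratio m n a X w") auto
    with less have "s < t"
      by (simp add: ennreal_less_iff)
    then have "(?cap w, s) \<in> S"
      using cap_box[OF w] cap_le[OF w] s z(3) by (simp add: S_iff)
    with p(2) \<open>s < t\<close> show False
      by (fastforce simp: zt)
  qed
  then have "ennreal t \<le> stab_index m n a X"
    unfolding stab_index_def by (intro INF_greatest) simp
  moreover have "stab_index m n a X \<le> max_stab_ratio m n a X z"
    unfolding stab_index_def using box_nonneg[OF z(1)] by (intro INF_lower) simp
  ultimately show ?thesis
    using box_nonneg[OF z(1)] z(4) by (metis order.antisym order.trans)
qed

section \<open>The reciprocal formula\<close>

text \<open>Attainment matters from right to left: a minimiser is the \<open>z\<close> that
  witnesses support, even when equality holds.\<close>

lemma supports_core_iff_stab_index: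
  assumes "\<forall>i\<in>{1..m}. \<forall>j\<in>{1..n}. 0 \<le> a i j" "complete_matching m n X" "0 < \<alpha>"
  shows "supports_core m n a X \<alpha> \<longleftrightarrow> stab_index m n a X \<le> ennreal (1 / \<alpha>)"
proof -
  have "stab_index m n a X \<le> max_stab_ratio m n a X z" if "nonneg_on {1..n} z" for z
    unfolding stab_index_def using that by (intro INF_lower) simp
  then show ?thesis
    using supports_core_iff_max_stab_ratio[OF assms] stab_index_attained[OF assms(1,2)]
    by (metis order.trans)
qed

text \<open>Both sides hold for \<open>r = 0\<close> and fail for infinite \<open>r\<close>, by the
  conventions for division.\<close>

lemma ennreal_le_one_divide_iff:
  assumes "0 < \<alpha>"
  shows "ennreal \<alpha> \<le> 1 / r \<longleftrightarrow> r \<le> ennreal (1 / \<alpha>)"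
proof (cases r)
  case (real s)
  show ?thesis
  proof (cases "s = 0")
    case True
    then show ?thesis
      using real by (simp add: divide_ennreal_def)
  next
    case False
    then have "1 / r = ennreal (1 / s)"
      using real by (simp add: divide_ennreal flip: ennreal_1)
    then show ?thesis
      using real False assms by (simp add: field_simps)
  qed
next
  case top
  then show ?thesis
    using assms by (simp add: divide_ennreal_def top_unique)
qed

lemma core_ratio_eq:
  assumes "\<forall>i\<in>{1..m}. \<forall>j\<in>{1..n}. 0 \<le> a i j" "complete_matching m n X"
  shows "core_ratio m n a X = 1 / stab_index m n a X"
proof -
  have iff: "supports_core m n a X \<alpha> \<longleftrightarrow> ennreal \<alpha> \<le> 1 / stab_index m n a X" if "0 < \<alpha>" for \<alpha>
    using supports_core_iff_stab_index[OF assms that] ennreal_le_one_divide_iff[OF that] by simp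
  show ?thesis
  proof (rule antisym)
    show "core_ratio m n a X \<le> 1 / stab_index m n a X"
      unfolding core_ratio_def
    proof (rule SUP_least)
      fix \<alpha> assume "\<alpha> \<in> {\<alpha>. 0 \<le> \<alpha> \<and> supports_core m n a X \<alpha>}"
      then show "ennreal \<alpha> \<le> 1 / stab_index m n a X"
        using iff[of \<alpha>] by (cases "\<alpha> = 0") auto
    qed
    show "1 / stab_index m n a X \<le> core_ratio m n a X"
    \<comment> \<open>Anything strictly below the reciprocal is finite, hence a real number to which
      \<open>iff\<close> applies; this also handles an infinite reciprocal.\<close>
    proof (rule dense_le)
      fix u assume u: "u < 1 / stab_index m n a X"
      then obtain \<alpha> where \<alpha>: "0 \<le> \<alpha>" "u = ennreal \<alpha>"
        by (cases u) auto
      show "u \<le> core_ratio m n a X"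
      proof (cases "\<alpha> = 0")
        case False
        with \<alpha> u iff[of \<alpha>] show ?thesis
          unfolding core_ratio_def by (intro SUP_upper2[of \<alpha>]) auto
      qed (simp add: \<alpha>)
    qed
  qed
qed

theorem theorem1:
  fixes m n :: nat and a :: "nat \<Rightarrow> nat \<Rightarrow> real" and X :: "nat \<Rightarrow> nat set"
  assumes "\<forall>i\<in>{1..m}. \<forall>j\<in>{1..n}. 0 \<le> a i j"
    and "complete_matching m n X"
  shows "(\<forall>\<alpha>>0. supports_core m n a X \<alpha> \<longleftrightarrow>
            (\<exists>z. nonneg_on {1..n} z \<and> (\<forall>i\<in>{1..m}. ennreal \<alpha> * stab_ratio n a X z i \<le> 1))) \<and>
         (\<exists>z. nonneg_on {1..n} z \<and> max_stab_ratio m n a X z = stab_index m n a X) \<and>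
         core_ratio m n a X = 1 / stab_index m n a X"
proof (intro conjI allI impI)
  fix \<alpha> :: real assume "0 < \<alpha>"
  then show "supports_core m n a X \<alpha> \<longleftrightarrow>
      (\<exists>z. nonneg_on {1..n} z \<and> (\<forall>i\<in>{1..m}. ennreal \<alpha> * stab_ratio n a X z i \<le> 1))"
    using supports_core_iff_max_stab_ratio[OF assms]
    by (simp add: ennreal_mult_le_one_iff max_stab_ratio_def SUP_le_iff)
next
  show "\<exists>z. nonneg_on {1..n} z \<and> max_stab_ratio m n a X z = stab_index m n a X"
    using assms by (rule stab_index_attained)
next
  show "core_ratio m n a X = 1 / stab_index m n a X"
    using assms by (rule core_ratio_eq)
qed

end
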